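(* Let $X$ be a random $d$-vector with characteristic function $\phi_X(t) = \mathbb{E}[\exp(i\,t\cdot X)]$, $t \in \mathbb{R}^d$. Suppose that there exists $t^* \in \mathbb{R}^d$, $t^* \neq 0$, such that $|\phi_X(t^* )| = 1$. Then the distribution of $X$ is semi-lattice.
   Context: Semi-lattice distribution: a random $d$-vector $X$ has a semi-lattice distribution if there exists $\mathbf{t} \in \mathbb{R}^d \setminus \{0\}$ such that $\mathbf{t} \cdot X$ takes values almost surely in a set $\{x_0 + k\delta : k\in\mathbb{Z}\}$ for some $x_0, \delta \in \mathbb{R}$. *)

theory Defs
  imports "HOL-Probability.Probability"
begin

text \<open>The library's \<^const>\<open>char\<close> is the characteristic function of a measure on the real line;
  this is its analogue for a random vector.\<close>

definition vec_char :: "'a measure \<Rightarrow> ('a \<Rightarrow> real ^ 'd) \<Rightarrow> real ^ 'd \<Rightarrow> complex"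
  where "vec_char M X t = (CLINT \<omega>|M. iexp (t \<bullet> X \<omega>))"

text \<open>The span \<open>\<delta>\<close> may be zero, in which case \<open>t \<bullet> X\<close> is almost surely constant.\<close>

definition semi_lattice :: "'a measure \<Rightarrow> ('a \<Rightarrow> real ^ 'd) \<Rightarrow> bool"
  where "semi_lattice M X \<longleftrightarrow>
    (\<exists>t. t \<noteq> 0 \<and> (\<exists>x\<^sub>0 \<delta> :: real.
      AE \<omega> in M. t \<bullet> X \<omega> \<in> {x\<^sub>0 + of_int k * \<delta> | k :: int. True}))"

end

theory Submission
  imports Defs
begin

text \<open>Write \<open>\<phi>(t) = exp(i\<theta>)\<close>. Then \<open>E[1 - cos(t \<bullet> X - \<theta>)] = 0\<close> with a nonnegative integrand, so
  \<open>cos(t \<bullet> X - \<theta>) = 1\<close> almost surely, that is, \<open>t \<bullet> X \<in> \<theta> + 2\<pi>\<int>\<close>.\<close>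

theorem proposition2p9:
  fixes M :: "'a measure" and X :: "'a \<Rightarrow> real ^ 'd"
  assumes "prob_space M"
    and "X \<in> borel_measurable M"
    and "\<exists>t. t \<noteq> 0 \<and> cmod (vec_char M X t) = 1"
  shows "semi_lattice M X"
proof -
  interpret prob_space M by fact
  note [measurable] = assms(2)
  obtain t where t: "t \<noteq> 0" "cmod (vec_char M X t) = 1"
    using assms(3) by blast
  define \<theta> where "\<theta> = Arg (vec_char M X t)"
  \<comment> \<open>Modulus 1 makes the value nonzero, as \<open>Arg_eq\<close> requires, and leaves
    only the phase factor of its polar form.\<close>
  have phi: "vec_char M X t = iexp \<theta>"
    using t(2) Arg_eq[of "vec_char M X t"] by (fastforce simp: \<theta>_def)
  have int: "integrable M (\<lambda>\<omega>. iexp (t \<bullet> X \<omega>))"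
    by (rule integrable_const_bound[where B = 1]) auto
  have intc: "integrable M (\<lambda>\<omega>. cos (t \<bullet> X \<omega> - \<theta>))"
    by (rule integrable_const_bound[where B = 1]) auto
  \<comment> \<open>Multiplication by \<open>iexp (- \<theta>)\<close> rotates the value at
    \<open>t\<close> to 1. The identity serves twice: under the expectation, and at
    \<open>x = \<theta>\<close>, where it gives cos 0 = 1.\<close>
  have rot: "Re (iexp (- \<theta>) * iexp x) = cos (x - \<theta>)" for x
    by (simp add: cos_diff Re_exp Im_exp)
  have "expectation (\<lambda>\<omega>. cos (t \<bullet> X \<omega> - \<theta>)) = expectation (\<lambda>\<omega>. Re (iexp (- \<theta>) * iexp (t \<bullet> X \<omega>)))"
    by (simp only: rot)
  \<comment> \<open>By \<open>int\<close>, the real part and the constant factor may leave the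
    integral.\<close>
  also have "\<dots> = Re (iexp (- \<theta>) * vec_char M X t)"
    using int by (subst integral_Re) (simp_all add: vec_char_def)
  also have "\<dots> = 1"
    by (simp only: phi rot) simp
  finally have "expectation (\<lambda>\<omega>. 1 - cos (t \<bullet> X \<omega> - \<theta>)) = 0"
    using intc by (simp add: prob_space)
  then have "AE \<omega> in M. 1 - cos (t \<bullet> X \<omega> - \<theta>) = 0"
    using intc by (subst (asm) integral_nonneg_eq_0_iff_AE) auto
  \<comment> \<open>The span is the period of the cosine, the offset is the phase \<theta>.\<close>
  then have "AE \<omega> in M. t \<bullet> X \<omega> \<in> {\<theta> + of_int k * (2 * pi) | k :: int. True}"
  proof eventually_elim
    case (elim \<omega>)
    then obtain k :: int where "t \<bullet> X \<omega> - \<theta> = of_int k * 2 * pi"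
      using cos_one_2pi_int[of "t \<bullet> X \<omega> - \<theta>"] by auto
    then have "t \<bullet> X \<omega> = \<theta> + of_int k * (2 * pi)"
      by simp
    then show ?case by blast
  qed
  then show ?thesis
    unfolding semi_lattice_def using t(1) by blast
qed

end
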